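(* Let $(\mu_\circ,\eta_\circ,\delta_\circ,\epsilon_\circ)$ and $(\mu_\bullet,\eta_\bullet,\delta_\bullet,\epsilon_\bullet)$ form a GHZ/W-pair on an object $Q$ of a symmetric monoidal category $\mathbf V$, and assume $\{\eta_\bullet,\tau\circ\eta_\bullet\}$ is a plugging set for $Q$. For $\psi:I\to Q$ let $\Phi_\psi:=\mu_\circ\circ(1_Q\otimes\psi)$ and $\Phi_{1/\psi}:=\tau\circ\Phi_\psi\circ\tau$. Then $$\Phi_{1/\psi}\circ\Phi_\psi=(\epsilon_\bullet\circ\psi)\cdot(\epsilon_\bullet\circ\tau\circ\psi)\cdot 1_Q.$$
   Context: Let $(\mathbf V,\otimes,I,\sigma)$ be a symmetric monoidal category; scalars are morphisms $I\to I$ and $s\cdot f$ denotes $s\otimes f$ with $I\otimes X\cong X$. A commutative Frobenius algebra (CFA) on $Q$ is a commutative monoid $(Q,\mu,\eta)$ and cocommutative comonoid $(Q,\delta,\epsilon)$ with $(1\otimes\mu)(\delta\otimes 1)=\delta\mu=(\mu\otimes1)(1\otimes\delta)$. It is special if $\mu\circ\delta=1_Q$, and anti-special if $c\cdot(\mu\circ\delta)=(\mu\circ\delta\circ\eta)\circ(\epsilon\circ\mu\circ\delta)$ where $c=\epsilon\circ\mu\circ\delta\circ\eta$. A GHZ-structure is a special CFA $(\mu_\circ,\eta_\circ,\delta_\circ,\epsilon_\circ)$, a W-structure an anti-special CFA $(\mu_\bullet,\eta_\bullet,\delta_\bullet,\epsilon_\bullet)$, both on $Q$. Define $\tau:=(\epsilon_\bullet\mu_\bullet\otimes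 1_Q)\circ(1_Q\otimes\delta_\circ\eta_\circ):Q\to Q$. They form a GHZ/W-pair if: ($\alpha$) $\tau=(\epsilon_\circ\mu_\circ\otimes 1_Q)\circ(1_Q\otimes\delta_\bullet\eta_\bullet)$; ($\beta$) $\delta_\circ\circ\eta_\bullet=\eta_\bullet\otimes\eta_\bullet$; ($\gamma$) $\delta_\circ\circ\tau=(\tau\otimes\tau)\circ\delta_\circ$; ($\xi$) $(\epsilon_\bullet\mu_\bullet\delta_\bullet\eta_\bullet)\cdot(\tau\circ\eta_\bullet)=\mu_\bullet\circ\delta_\bullet\circ\eta_\bullet$. A set of points $\{\psi_i:I\to Q\}$ is a plugging set if for all objects $A$ and $f,g:Q\to A$, $f=g$ iff $f\circ\psi_i=g\circ\psi_i$ for all $i$. *)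

theory Defs
  imports Main
begin

record ('o, 'm) cat_struct =
  obj :: "'o set"
  arr :: "'m set"
  src :: "'m \<Rightarrow> 'o"
  tgt :: "'m \<Rightarrow> 'o"
  idm :: "'o \<Rightarrow> 'm"
  cmp :: "'m \<Rightarrow> 'm \<Rightarrow> 'm" (infixr "\<odot>\<index>" 55)

definition hom :: "('o, 'm, 'b) cat_struct_scheme \<Rightarrow> 'o \<Rightarrow> 'o \<Rightarrow> 'm set" where
  "hom V A B = {f \<in> arr V. src V f = A \<and> tgt V f = B}"

locale category =
  fixes V :: "('o, 'm, 'b) cat_struct_scheme" (structure)
  assumes src_obj: "f \<in> arr V \<Longrightarrow> src V f \<in> obj V"
    and tgt_obj: "f \<in> arr V \<Longrightarrow> tgt V f \<in> obj V"
    and idm_hom: "A \<in> obj V \<Longrightarrow> idm V A \<in> hom V A A"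
    and cmp_hom: "\<lbrakk>f \<in> hom V A B; g \<in> hom V B C\<rbrakk> \<Longrightarrow> g \<odot> f \<in> hom V A C"
    and cmp_idm_left: "f \<in> hom V A B \<Longrightarrow> idm V B \<odot> f = f"
    and cmp_idm_right: "f \<in> hom V A B \<Longrightarrow> f \<odot> idm V A = f"
    and cmp_assoc: "\<lbrakk>f \<in> hom V A B; g \<in> hom V B C; h \<in> hom V C D\<rbrakk>
        \<Longrightarrow> (h \<odot> g) \<odot> f = h \<odot> (g \<odot> f)"

definition inverse_arrows :: "('o, 'm, 'b) cat_struct_scheme \<Rightarrow> 'm \<Rightarrow> 'm \<Rightarrow> bool" where
  "inverse_arrows V f g \<longleftrightarrow>
     f \<in> arr V \<and> g \<in> hom V (tgt V f) (src V f) \<and>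
     g \<odot>\<^bsub>V\<^esub> f = idm V (src V f) \<and> f \<odot>\<^bsub>V\<^esub> g = idm V (tgt V f)"

definition iso :: "('o, 'm, 'b) cat_struct_scheme \<Rightarrow> 'm \<Rightarrow> bool" where
  "iso V f \<longleftrightarrow> (\<exists>g. inverse_arrows V f g)"

definition inv_arr :: "('o, 'm, 'b) cat_struct_scheme \<Rightarrow> 'm \<Rightarrow> 'm" where
  "inv_arr V f = (THE g. inverse_arrows V f g)"

record ('o, 'm) smc_struct = "('o, 'm) cat_struct" +
  tensor_obj :: "'o \<Rightarrow> 'o \<Rightarrow> 'o" (infixl "\<boxtimes>\<index>" 70)
  tensor :: "'m \<Rightarrow> 'm \<Rightarrow> 'm" (infixl "\<otimes>\<index>" 70)
  unit_obj :: "'o" ("\<one>\<index>")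
  assoc :: "'o \<Rightarrow> 'o \<Rightarrow> 'o \<Rightarrow> 'm"
  lunit :: "'o \<Rightarrow> 'm"
  runit :: "'o \<Rightarrow> 'm"
  braid :: "'o \<Rightarrow> 'o \<Rightarrow> 'm"

text \<open>Mac Lane's axioms for a (not necessarily strict) symmetric monoidal category. The axioms
  \<open>lunit_eq_runit\<close> and \<open>braid_unit\<close> follow from the others, but are part of his definition.\<close>

locale symmetric_monoidal_category = category V
  for V :: "('o, 'm, 'b) smc_struct_scheme" (structure) +
  assumes unit_obj: "\<one> \<in> obj V"
    and tensor_obj: "\<lbrakk>A \<in> obj V; B \<in> obj V\<rbrakk> \<Longrightarrow> A \<boxtimes> B \<in> obj V"
    and tensor_hom: "\<lbrakk>f \<in> hom V A B; g \<in> hom V C D\<rbrakk> \<Longrightarrow> f \<otimes> g \<in> hom V (A \<boxtimes> C) (B \<boxtimes> D)"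
    and tensor_idm: "\<lbrakk>A \<in> obj V; B \<in> obj V\<rbrakk> \<Longrightarrow> idm V A \<otimes> idm V B = idm V (A \<boxtimes> B)"
    and interchange: "\<lbrakk>f \<in> hom V A B; g \<in> hom V B C; f' \<in> hom V A' B'; g' \<in> hom V B' C'\<rbrakk>
        \<Longrightarrow> (g \<odot> f) \<otimes> (g' \<odot> f') = (g \<otimes> g') \<odot> (f \<otimes> f')"
    and assoc_hom: "\<lbrakk>A \<in> obj V; B \<in> obj V; C \<in> obj V\<rbrakk>
        \<Longrightarrow> assoc V A B C \<in> hom V ((A \<boxtimes> B) \<boxtimes> C) (A \<boxtimes> (B \<boxtimes> C))"
    and assoc_iso: "\<lbrakk>A \<in> obj V; B \<in> obj V; C \<in> obj V\<rbrakk> \<Longrightarrow> iso V (assoc V A B C)"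
    and assoc_natural: "\<lbrakk>f \<in> hom V A A'; g \<in> hom V B B'; h \<in> hom V C C'\<rbrakk>
        \<Longrightarrow> assoc V A' B' C' \<odot> ((f \<otimes> g) \<otimes> h) = (f \<otimes> (g \<otimes> h)) \<odot> assoc V A B C"
    and lunit_hom: "A \<in> obj V \<Longrightarrow> lunit V A \<in> hom V (\<one> \<boxtimes> A) A"
    and lunit_iso: "A \<in> obj V \<Longrightarrow> iso V (lunit V A)"
    and lunit_natural: "f \<in> hom V A B \<Longrightarrow> lunit V B \<odot> (idm V \<one> \<otimes> f) = f \<odot> lunit V A"
    and runit_hom: "A \<in> obj V \<Longrightarrow> runit V A \<in> hom V (A \<boxtimes> \<one>) A"
    and runit_iso: "A \<in> obj V \<Longrightarrow> iso V (runit V A)"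
    and runit_natural: "f \<in> hom V A B \<Longrightarrow> runit V B \<odot> (f \<otimes> idm V \<one>) = f \<odot> runit V A"
    and pentagon: "\<lbrakk>A \<in> obj V; B \<in> obj V; C \<in> obj V; D \<in> obj V\<rbrakk>
        \<Longrightarrow> assoc V A B (C \<boxtimes> D) \<odot> assoc V (A \<boxtimes> B) C D =
            (idm V A \<otimes> assoc V B C D) \<odot> assoc V A (B \<boxtimes> C) D \<odot> (assoc V A B C \<otimes> idm V D)"
    and triangle: "\<lbrakk>A \<in> obj V; B \<in> obj V\<rbrakk>
        \<Longrightarrow> (idm V A \<otimes> lunit V B) \<odot> assoc V A \<one> B = runit V A \<otimes> idm V B"
    and lunit_eq_runit: "lunit V \<one> = runit V \<one>"
    and braid_hom: "\<lbrakk>A \<in> obj V; B \<in> obj V\<rbrakk> \<Longrightarrow> braid V A B \<in> hom V (A \<boxtimes> B) (B \<boxtimes> A)"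
    and braid_natural: "\<lbrakk>f \<in> hom V A A'; g \<in> hom V B B'\<rbrakk>
        \<Longrightarrow> braid V A' B' \<odot> (f \<otimes> g) = (g \<otimes> f) \<odot> braid V A B"
    and braid_braid: "\<lbrakk>A \<in> obj V; B \<in> obj V\<rbrakk> \<Longrightarrow> braid V B A \<odot> braid V A B = idm V (A \<boxtimes> B)"
    and braid_unit: "A \<in> obj V \<Longrightarrow> lunit V A \<odot> braid V A \<one> = runit V A"
    and hexagon: "\<lbrakk>A \<in> obj V; B \<in> obj V; C \<in> obj V\<rbrakk>
        \<Longrightarrow> assoc V B C A \<odot> braid V A (B \<boxtimes> C) \<odot> assoc V A B C =
            (idm V B \<otimes> braid V A C) \<odot> assoc V B A C \<odot> (braid V A B \<otimes> idm V C)"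

text \<open>The action \<open>s \<cdot> f\<close> of a scalar, i.e. \<open>s \<otimes> f\<close> transported along \<open>I \<otimes> X \<cong> X\<close>.\<close>

definition scalar_mult :: "('o, 'm, 'b) smc_struct_scheme \<Rightarrow> 'm \<Rightarrow> 'm \<Rightarrow> 'm"
    (infixr "\<cdot>\<index>" 65) where
  "s \<cdot>\<^bsub>V\<^esub> f =
     lunit V (tgt V f) \<odot>\<^bsub>V\<^esub> (s \<otimes>\<^bsub>V\<^esub> f) \<odot>\<^bsub>V\<^esub> inv_arr V (lunit V (src V f))"

record 'm frob_struct =
  mu :: "'m"
  eta :: "'m"
  delta :: "'m"
  eps :: "'m"

locale comm_frobenius_algebra = symmetric_monoidal_category V
  for V :: "('o, 'm, 'b) smc_struct_scheme" (structure) +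
  fixes Q :: 'o and F :: "'m frob_struct"
  assumes carrier_obj: "Q \<in> obj V"
    and mu_hom: "mu F \<in> hom V (Q \<boxtimes> Q) Q"
    and eta_hom: "eta F \<in> hom V \<one> Q"
    and delta_hom: "delta F \<in> hom V Q (Q \<boxtimes> Q)"
    and eps_hom: "eps F \<in> hom V Q \<one>"
    and mu_assoc: "mu F \<odot> (mu F \<otimes> idm V Q) = mu F \<odot> (idm V Q \<otimes> mu F) \<odot> assoc V Q Q Q"
    and mu_unit_left: "mu F \<odot> (eta F \<otimes> idm V Q) = lunit V Q"
    and mu_unit_right: "mu F \<odot> (idm V Q \<otimes> eta F) = runit V Q"
    and mu_comm: "mu F \<odot> braid V Q Q = mu F"
    and delta_coassoc:
      "assoc V Q Q Q \<odot> (delta F \<otimes> idm V Q) \<odot> delta F = (idm V Q \<otimes> delta F) \<odot> delta F"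
    and delta_counit_left: "lunit V Q \<odot> (eps F \<otimes> idm V Q) \<odot> delta F = idm V Q"
    and delta_counit_right: "runit V Q \<odot> (idm V Q \<otimes> eps F) \<odot> delta F = idm V Q"
    and delta_cocomm: "braid V Q Q \<odot> delta F = delta F"
    and frobenius_left:
      "(idm V Q \<otimes> mu F) \<odot> assoc V Q Q Q \<odot> (delta F \<otimes> idm V Q) = delta F \<odot> mu F"
    and frobenius_right:
      "(mu F \<otimes> idm V Q) \<odot> inv_arr V (assoc V Q Q Q) \<odot> (idm V Q \<otimes> delta F) = delta F \<odot> mu F"

locale GHZ_structure = comm_frobenius_algebra V Q F
  for V :: "('o, 'm, 'b) smc_struct_scheme" (structure) and Q F +
  assumes special: "mu F \<odot> delta F = idm V Q"

locale W_structure = comm_frobenius_algebra V Q F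
  for V :: "('o, 'm, 'b) smc_struct_scheme" (structure) and Q F +
  assumes anti_special:
    "(eps F \<odot> mu F \<odot> delta F \<odot> eta F) \<cdot> (mu F \<odot> delta F) =
     (mu F \<odot> delta F \<odot> eta F) \<odot> (eps F \<odot> mu F \<odot> delta F)"

text \<open>\<open>cap_cup V Q F G\<close> is \<open>(\<epsilon>\<^sub>F \<mu>\<^sub>F \<otimes> 1) \<circ> (1 \<otimes> \<delta>\<^sub>G \<eta>\<^sub>G)\<close>, with the coherence isomorphisms
  \<open>Q \<rightarrow> Q \<otimes> I\<close>, \<open>Q \<otimes> (Q \<otimes> Q) \<rightarrow> (Q \<otimes> Q) \<otimes> Q\<close> and \<open>I \<otimes> Q \<rightarrow> Q\<close> made explicit.\<close>

definition cap_cup ::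
    "('o, 'm, 'b) smc_struct_scheme \<Rightarrow> 'o \<Rightarrow> 'm frob_struct \<Rightarrow> 'm frob_struct \<Rightarrow> 'm" where
  "cap_cup V Q F G =
     lunit V Q
     \<odot>\<^bsub>V\<^esub> ((eps F \<odot>\<^bsub>V\<^esub> mu F) \<otimes>\<^bsub>V\<^esub> idm V Q)
     \<odot>\<^bsub>V\<^esub> inv_arr V (assoc V Q Q Q)
     \<odot>\<^bsub>V\<^esub> (idm V Q \<otimes>\<^bsub>V\<^esub> (delta G \<odot>\<^bsub>V\<^esub> eta G))
     \<odot>\<^bsub>V\<^esub> inv_arr V (runit V Q)"

definition tau ::
    "('o, 'm, 'b) smc_struct_scheme \<Rightarrow> 'o \<Rightarrow> 'm frob_struct \<Rightarrow> 'm frob_struct \<Rightarrow> 'm" where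
  "tau V Q G W = cap_cup V Q W G"

locale GHZ_W_pair = GHZ: GHZ_structure V Q G + W: W_structure V Q W
  for V :: "('o, 'm, 'b) smc_struct_scheme" (structure) and Q G W +
  assumes alpha: "tau V Q G W = cap_cup V Q G W"
    and beta: "delta G \<odot> eta W = (eta W \<otimes> eta W) \<odot> inv_arr V (lunit V \<one>)"
    and gamma: "delta G \<odot> tau V Q G W = (tau V Q G W \<otimes> tau V Q G W) \<odot> delta G"
    and xi: "(eps W \<odot> mu W \<odot> delta W \<odot> eta W) \<cdot> (tau V Q G W \<odot> eta W) =
             mu W \<odot> delta W \<odot> eta W"

definition plugging_set :: "('o, 'm, 'b) smc_struct_scheme \<Rightarrow> 'o \<Rightarrow> 'm set \<Rightarrow> bool" where
  "plugging_set V Q P \<longleftrightarrow>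
     P \<subseteq> hom V \<one>\<^bsub>V\<^esub> Q \<and>
     (\<forall>A \<in> obj V. \<forall>f \<in> hom V Q A. \<forall>g \<in> hom V Q A.
        f = g \<longleftrightarrow> (\<forall>\<psi> \<in> P. f \<odot>\<^bsub>V\<^esub> \<psi> = g \<odot>\<^bsub>V\<^esub> \<psi>))"

definition Phi :: "('o, 'm, 'b) smc_struct_scheme \<Rightarrow> 'o \<Rightarrow> 'm frob_struct \<Rightarrow> 'm \<Rightarrow> 'm" where
  "Phi V Q G \<psi> = mu G \<odot>\<^bsub>V\<^esub> (idm V Q \<otimes>\<^bsub>V\<^esub> \<psi>) \<odot>\<^bsub>V\<^esub> inv_arr V (runit V Q)"

definition Phi_inv ::
    "('o, 'm, 'b) smc_struct_scheme \<Rightarrow> 'o \<Rightarrow> 'm frob_struct \<Rightarrow> 'm frob_struct \<Rightarrow> 'm \<Rightarrow> 'm" where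
  "Phi_inv V Q G W \<psi> = tau V Q G W \<odot>\<^bsub>V\<^esub> Phi V Q G \<psi> \<odot>\<^bsub>V\<^esub> tau V Q G W"

end

theory Submission
  imports Defs
begin

text \<open>Evaluated at a plugging point, both sides become scalar multiples of that point. The points
  \<open>\<eta>\<^sub>\<bullet>\<close> and \<open>\<tau> \<eta>\<^sub>\<bullet>\<close> are copied by \<open>\<delta>\<^sub>\<circ>\<close>, so by the Frobenius law they are eigenvectors of \<open>\<Phi>\<^sub>\<psi>\<close>,
  the eigenvalue of \<open>p\<close> being \<open>\<epsilon>\<^sub>\<circ> \<mu>\<^sub>\<circ> (p \<otimes> \<psi>)\<close>. By (\<open>\<alpha>\<close>) composition with \<open>\<tau>\<close> exchanges the pairings
  \<open>\<epsilon>\<^sub>\<circ> \<mu>\<^sub>\<circ>\<close> and \<open>\<epsilon>\<^sub>\<bullet> \<mu>\<^sub>\<bullet>\<close>; hence the two eigenvalues are \<open>\<epsilon>\<^sub>\<bullet> \<tau> \<psi>\<close> and \<open>\<epsilon>\<^sub>\<bullet> \<psi>\<close>, and \<open>\<tau> \<tau> x = x\<close> for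
  every point \<open>x\<close>. Thus \<open>\<tau>\<close> swaps the two eigenvectors, and \<open>\<tau> \<Phi>\<^sub>\<psi> \<tau> \<Phi>\<^sub>\<psi>\<close> multiplies each of them by the
  product of the eigenvalues.\<close>

section \<open>Arrows typed by source and target, and isomorphisms\<close>

context category
begin

lemma homD: "f \<in> hom V A B \<Longrightarrow> f \<in> arr V \<and> src V f = A \<and> tgt V f = B \<and> A \<in> obj V \<and> B \<in> obj V"
  using src_obj tgt_obj by (auto simp: hom_def)

lemma idm_arr [simp]:
  assumes "A \<in> obj V"
  shows "idm V A \<in> arr V" "src V (idm V A) = A" "tgt V (idm V A) = A"
  using homD[OF idm_hom[OF assms]] by auto

lemma cmp_arr [simp]:
  assumes "f \<in> arr V" "g \<in> arr V" "tgt V f = src V g"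
  shows "g \<odot> f \<in> arr V" "src V (g \<odot> f) = src V f" "tgt V (g \<odot> f) = tgt V g"
  using cmp_hom[of f "src V f" "tgt V f" g "tgt V g"] assms by (auto simp: hom_def)

lemma cmp_idm [simp]:
  "f \<in> arr V \<Longrightarrow> tgt V f = B \<Longrightarrow> idm V B \<odot> f = f"
  "f \<in> arr V \<Longrightarrow> src V f = A \<Longrightarrow> f \<odot> idm V A = f"
  using cmp_idm_left cmp_idm_right by (auto simp: hom_def)

lemma cmp_assoc_arr [simp]:
  "\<lbrakk>f \<in> arr V; g \<in> arr V; h \<in> arr V; tgt V f = src V g; tgt V g = src V h\<rbrakk>
    \<Longrightarrow> (h \<odot> g) \<odot> f = h \<odot> (g \<odot> f)"
  using cmp_assoc[of f "src V f" "tgt V f" g "tgt V g" h "tgt V h"] by (simp add: hom_def)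

text \<open>Composites are normalised to right-nested form, where an equation for
  \<open>g \<odot> f\<close> no longer matches once \<open>f\<close> is followed by a further factor
  \<open>k\<close>; this variant restores the match.\<close>

lemma cmp_reassoc:
  "\<lbrakk>g \<odot> f = h; k \<in> arr V; f \<in> arr V; g \<in> arr V; tgt V k = src V f; tgt V f = src V g\<rbrakk>
    \<Longrightarrow> g \<odot> (f \<odot> k) = h \<odot> k"
  by (metis cmp_assoc_arr)

lemma inverse_arrows_inv_arr:
  assumes "iso V f"
  shows "inverse_arrows V f (inv_arr V f)"
proof -
  obtain g where g: "inverse_arrows V f g"
    using assms by (auto simp: iso_def)
  have "h = g" if "inverse_arrows V f h" for h
  proof -
    have "h = h \<odot> (f \<odot> g)"
      using g that by (simp add: inverse_arrows_def hom_def)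
    also have "\<dots> = (h \<odot> f) \<odot> g"
      by (rule cmp_assoc_arr[symmetric]) (use g that in \<open>auto simp: inverse_arrows_def hom_def\<close>)
    also have "\<dots> = g"
      using g that by (simp add: inverse_arrows_def hom_def del: cmp_assoc_arr)
    finally show ?thesis .
  qed
  with g show ?thesis
    unfolding inv_arr_def by (metis theI)
qed

lemma inv_arr [simp]:
  assumes "iso V f"
  shows "inv_arr V f \<in> arr V" "src V (inv_arr V f) = tgt V f" "tgt V (inv_arr V f) = src V f"
    and "inv_arr V f \<odot> f = idm V (src V f)" "f \<odot> inv_arr V f = idm V (tgt V f)"
  using inverse_arrows_inv_arr[OF assms] by (auto simp: inverse_arrows_def hom_def)

lemma iso_arr: "iso V f \<Longrightarrow> f \<in> arr V"
  by (auto simp: iso_def inverse_arrows_def)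

lemma inv_arr_cancel [simp]:
  assumes "iso V f" "k \<in> arr V"
  shows "tgt V k = src V f \<Longrightarrow> inv_arr V f \<odot> (f \<odot> k) = k"
    and "tgt V k = tgt V f \<Longrightarrow> f \<odot> (inv_arr V f \<odot> k) = k"
  using assms by (simp_all add: cmp_reassoc[OF inv_arr(4)] cmp_reassoc[OF inv_arr(5)] iso_arr)

lemma iso_cancel_left:
  assumes "iso V f" "g \<in> arr V" "h \<in> arr V" "tgt V g = src V f" "tgt V h = src V f" "f \<odot> g = f \<odot> h"
  shows "g = h"
  by (metis assms inv_arr_cancel(1))

lemma iso_cancel_right:
  assumes "iso V f" "g \<in> arr V" "h \<in> arr V" "src V g = tgt V f" "src V h = tgt V f" "g \<odot> f = h \<odot> f"
  shows "g = h"
proof -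
  have "g = (g \<odot> f) \<odot> inv_arr V f" and "h = (h \<odot> f) \<odot> inv_arr V f"
    using assms(1-5) by (simp_all add: iso_arr)
  then show ?thesis
    using assms(6) by metis
qed

lemma inv_arr_natural:
  assumes "iso V a" "iso V b" "f \<in> arr V" "g \<in> arr V"
    and "src V f = src V a" "tgt V f = src V b" "src V g = tgt V a" "tgt V g = tgt V b"
    and "b \<odot> f = g \<odot> a"
  shows "inv_arr V b \<odot> g = f \<odot> inv_arr V a"
proof (rule iso_cancel_left[OF assms(2)])
  have "b \<odot> f \<odot> inv_arr V a = (b \<odot> f) \<odot> inv_arr V a"
    using assms(1-8) by (simp add: iso_arr)
  also have "\<dots> = g"
    unfolding assms(9) using assms(1-8) by (simp add: iso_arr)
  finally show "b \<odot> inv_arr V b \<odot> g = b \<odot> f \<odot> inv_arr V a"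
    using assms by simp
qed (use assms in \<open>simp_all add: iso_arr\<close>)

end

section \<open>Coherence with the unit object\<close>

context symmetric_monoidal_category
begin

declare unit_obj [simp] tensor_obj [simp] assoc_iso [simp] lunit_iso [simp] runit_iso [simp]
  tensor_idm [simp]

lemma tensor_arr [simp]:
  assumes "f \<in> arr V" "g \<in> arr V"
  shows "f \<otimes> g \<in> arr V" "src V (f \<otimes> g) = src V f \<boxtimes> src V g" "tgt V (f \<otimes> g) = tgt V f \<boxtimes> tgt V g"
  using tensor_hom[of f "src V f" "tgt V f" g "src V g" "tgt V g"] assms by (auto simp: hom_def)

lemma coherence_arr [simp]:
  "A \<in> obj V \<Longrightarrow> lunit V A \<in> arr V" "A \<in> obj V \<Longrightarrow> src V (lunit V A) = \<one> \<boxtimes> A"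
  "A \<in> obj V \<Longrightarrow> tgt V (lunit V A) = A"
  "A \<in> obj V \<Longrightarrow> runit V A \<in> arr V" "A \<in> obj V \<Longrightarrow> src V (runit V A) = A \<boxtimes> \<one>"
  "A \<in> obj V \<Longrightarrow> tgt V (runit V A) = A"
  "\<lbrakk>A \<in> obj V; B \<in> obj V\<rbrakk> \<Longrightarrow> braid V A B \<in> arr V"
  "\<lbrakk>A \<in> obj V; B \<in> obj V\<rbrakk> \<Longrightarrow> src V (braid V A B) = A \<boxtimes> B"
  "\<lbrakk>A \<in> obj V; B \<in> obj V\<rbrakk> \<Longrightarrow> tgt V (braid V A B) = B \<boxtimes> A"
  "\<lbrakk>A \<in> obj V; B \<in> obj V; C \<in> obj V\<rbrakk> \<Longrightarrow> assoc V A B C \<in> arr V"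
  "\<lbrakk>A \<in> obj V; B \<in> obj V; C \<in> obj V\<rbrakk> \<Longrightarrow> src V (assoc V A B C) = (A \<boxtimes> B) \<boxtimes> C"
  "\<lbrakk>A \<in> obj V; B \<in> obj V; C \<in> obj V\<rbrakk> \<Longrightarrow> tgt V (assoc V A B C) = A \<boxtimes> (B \<boxtimes> C)"
  using lunit_hom runit_hom braid_hom assoc_hom by (auto simp: hom_def)

lemma interchange_arr:
  "\<lbrakk>f \<in> arr V; g \<in> arr V; f' \<in> arr V; g' \<in> arr V; tgt V f = src V g; tgt V f' = src V g'\<rbrakk>
    \<Longrightarrow> (g \<otimes> g') \<odot> (f \<otimes> f') = (g \<odot> f) \<otimes> (g' \<odot> f')"
  by (rule interchange[symmetric]) (auto simp: hom_def)

lemma interchange_arr_cmp: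
  "\<lbrakk>f \<in> arr V; g \<in> arr V; f' \<in> arr V; g' \<in> arr V; k \<in> arr V;
    tgt V f = src V g; tgt V f' = src V g'; tgt V k = src V f \<boxtimes> src V f'\<rbrakk>
    \<Longrightarrow> (g \<otimes> g') \<odot> ((f \<otimes> f') \<odot> k) = ((g \<odot> f) \<otimes> (g' \<odot> f')) \<odot> k"
  by (rule cmp_reassoc[OF interchange_arr]) simp_all

lemma runit_inv_natural:
  assumes "f \<in> hom V A B"
  shows "inv_arr V (runit V B) \<odot> f = (f \<otimes> idm V \<one>) \<odot> inv_arr V (runit V A)"
  using homD[OF assms] by (intro inv_arr_natural) (simp_all add: runit_natural[OF assms])

lemma lunit_inv_natural:
  assumes "f \<in> hom V A B"
  shows "inv_arr V (lunit V B) \<odot> f = (idm V \<one> \<otimes> f) \<odot> inv_arr V (lunit V A)"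
  using homD[OF assms] by (intro inv_arr_natural) (simp_all add: lunit_natural[OF assms])

text \<open>Naturality of the right unitor makes tensoring with the unit object isomorphic to the
  identity functor, hence faithful.\<close>

lemma tensor_unit_faithful:
  assumes "f \<in> hom V A B" "g \<in> hom V A B" "f \<otimes> idm V \<one> = g \<otimes> idm V \<one>"
  shows "f = g"
  using iso_cancel_right[OF runit_iso, of A f g] homD[OF assms(1)] homD[OF assms(2)]
    runit_natural[OF assms(1)] runit_natural[OF assms(2)] assms(3) by simp

text \<open>Kelly's redundancy argument: after tensoring with the unit object on the right, the claim
  is the pentagon for \<open>A, B, I, I\<close> composed with \<open>1 \<otimes> (1 \<otimes> \<lambda>)\<close>.\<close>

lemma runit_tensor:
  assumes A [simp]: "A \<in> obj V" and B [simp]: "B \<in> obj V"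
  shows "(idm V A \<otimes> runit V B) \<odot> assoc V A B \<one> = runit V (A \<boxtimes> B)"
proof (rule tensor_unit_faithful)
  let ?\<alpha> = "assoc V A B \<one>" and ?l = "idm V A \<otimes> (idm V B \<otimes> lunit V \<one>)"
  have "?\<alpha> \<odot> (runit V (A \<boxtimes> B) \<otimes> idm V \<one>)
      = ?\<alpha> \<odot> ((idm V A \<otimes> idm V B) \<otimes> lunit V \<one>) \<odot> assoc V (A \<boxtimes> B) \<one> \<one>"
    by (simp add: triangle)
  also have "\<dots> = (?\<alpha> \<odot> ((idm V A \<otimes> idm V B) \<otimes> lunit V \<one>)) \<odot> assoc V (A \<boxtimes> B) \<one> \<one>"
    by simp
  also have "\<dots> = (?l \<odot> assoc V A B (\<one> \<boxtimes> \<one>)) \<odot> assoc V (A \<boxtimes> B) \<one> \<one>"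
    by (subst assoc_natural[of _ A A _ B B _ "\<one> \<boxtimes> \<one>" \<one>]) (simp_all add: hom_def)
  also have "\<dots> = ?l \<odot> (idm V A \<otimes> assoc V B \<one> \<one>) \<odot> assoc V A (B \<boxtimes> \<one>) \<one> \<odot> (?\<alpha> \<otimes> idm V \<one>)"
    by (simp add: pentagon)
  also have "\<dots> = (idm V A \<otimes> (runit V B \<otimes> idm V \<one>)) \<odot> assoc V A (B \<boxtimes> \<one>) \<one> \<odot> (?\<alpha> \<otimes> idm V \<one>)"
    by (simp add: interchange_arr_cmp triangle)
  also have "\<dots> = ((idm V A \<otimes> (runit V B \<otimes> idm V \<one>)) \<odot> assoc V A (B \<boxtimes> \<one>) \<one>) \<odot> (?\<alpha> \<otimes> idm V \<one>)"
    by simp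
  also have "\<dots> = (?\<alpha> \<odot> ((idm V A \<otimes> runit V B) \<otimes> idm V \<one>)) \<odot> (?\<alpha> \<otimes> idm V \<one>)"
    by (subst assoc_natural[of _ A A _ "B \<boxtimes> \<one>" B _ \<one> \<one>]) (simp_all add: hom_def)
  also have "\<dots> = ?\<alpha> \<odot> (((idm V A \<otimes> runit V B) \<odot> ?\<alpha>) \<otimes> idm V \<one>)"
    by (simp add: interchange_arr)
  finally have *: "?\<alpha> \<odot> (runit V (A \<boxtimes> B) \<otimes> idm V \<one>) = \<dots>" .
  show "((idm V A \<otimes> runit V B) \<odot> ?\<alpha>) \<otimes> idm V \<one> = runit V (A \<boxtimes> B) \<otimes> idm V \<one>"
    by (rule iso_cancel_left[OF _ _ _ _ _ *[symmetric]]) simp_all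
qed (simp_all add: hom_def)

lemma runit_tensor_assoc_inv:
  assumes [simp]: "A \<in> obj V" "B \<in> obj V"
  shows "runit V (A \<boxtimes> B) \<odot> inv_arr V (assoc V A B \<one>) = idm V A \<otimes> runit V B"
  by (simp flip: runit_tensor)

lemma runit_inv_tensor:
  assumes [simp]: "A \<in> obj V" "B \<in> obj V"
  shows "assoc V A B \<one> \<odot> inv_arr V (runit V (A \<boxtimes> B)) = idm V A \<otimes> inv_arr V (runit V B)"
proof -
  let ?r = "runit V (A \<boxtimes> B)"
  have "idm V A \<otimes> inv_arr V (runit V B)
      = (idm V A \<otimes> inv_arr V (runit V B)) \<odot> ?r \<odot> inv_arr V ?r"
    by simp
  also have "\<dots> = (idm V A \<otimes> inv_arr V (runit V B)) \<odot> (idm V A \<otimes> runit V B)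
      \<odot> assoc V A B \<one> \<odot> inv_arr V ?r"
    by (subst runit_tensor[symmetric]) simp_all
  also have "\<dots> = assoc V A B \<one> \<odot> inv_arr V ?r"
    by (simp add: interchange_arr_cmp)
  finally show ?thesis ..
qed

section \<open>Scalars, the unit braiding, and sliding through the cap-cup map\<close>

lemma scalar_mult_cmp:
  assumes "s \<in> hom V \<one> \<one>" "f \<in> hom V B C" "g \<in> hom V A B"
  shows "(s \<cdot> f) \<odot> g = s \<cdot> (f \<odot> g)"
  using homD[OF assms(1)] homD[OF assms(2)] homD[OF assms(3)]
  by (simp add: scalar_mult_def lunit_inv_natural[OF assms(3)] interchange_arr_cmp)

lemma scalar_mult_hom:
  assumes "s \<in> hom V \<one> \<one>" "f \<in> hom V A B"
  shows "s \<cdot> f \<in> hom V A B"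
  using homD[OF assms(1)] homD[OF assms(2)] by (simp add: scalar_mult_def hom_def)

lemma lunit_conj_scalar:
  assumes "s \<in> hom V \<one> \<one>"
  shows "lunit V \<one> \<odot> (s \<otimes> idm V \<one>) \<odot> inv_arr V (lunit V \<one>) = s"
    and "lunit V \<one> \<odot> (idm V \<one> \<otimes> s) \<odot> inv_arr V (lunit V \<one>) = s"
  using homD[OF assms] cmp_reassoc[OF runit_natural[OF assms]] cmp_reassoc[OF lunit_natural[OF assms]]
  by (simp_all add: lunit_eq_runit)

text \<open>Split \<open>s \<otimes> p\<close> so that \<open>s\<close> acts first; naturality of
  the left unitor then pulls \<open>p\<close> out to the left.\<close>

lemma scalar_mult_point:
  assumes "s \<in> hom V \<one> \<one>" "p \<in> hom V \<one> A"
  shows "s \<cdot> p = p \<odot> s"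
proof -
  note [simp] = homD[OF assms(1)] homD[OF assms(2)]
  have "s \<cdot> p = lunit V A \<odot> (idm V \<one> \<otimes> p) \<odot> (s \<otimes> idm V \<one>) \<odot> inv_arr V (lunit V \<one>)"
    by (simp add: scalar_mult_def interchange_arr_cmp)
  also have "\<dots> = p \<odot> lunit V \<one> \<odot> (s \<otimes> idm V \<one>) \<odot> inv_arr V (lunit V \<one>)"
    by (simp add: cmp_reassoc[OF lunit_natural[OF assms(2)]])
  finally show ?thesis
    by (simp add: lunit_conj_scalar[OF assms(1)])
qed

text \<open>Eckmann-Hilton: both composites equal the tensor product of \<open>s\<close> and
  \<open>t\<close> conjugated by the unitor, because the two unitors agree at the unit
  object.\<close>

lemma scalar_commute:
  assumes "s \<in> hom V \<one> \<one>" "t \<in> hom V \<one> \<one>"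
  shows "s \<odot> t = t \<odot> s"
proof -
  note [simp] = homD[OF assms(1)] homD[OF assms(2)]
  let ?l = "lunit V \<one>"
  have "s \<odot> t = (?l \<odot> (s \<otimes> idm V \<one>) \<odot> inv_arr V ?l) \<odot> (?l \<odot> (idm V \<one> \<otimes> t) \<odot> inv_arr V ?l)"
    by (simp only: lunit_conj_scalar[OF assms(1)] lunit_conj_scalar[OF assms(2)])
  also have "\<dots> = (s \<cdot> t)"
    by (simp add: scalar_mult_def interchange_arr_cmp)
  finally show ?thesis
    by (simp add: scalar_mult_point[OF assms])
qed

lemma braid_unit_unit: "braid V \<one> \<one> = idm V (\<one> \<boxtimes> \<one>)"
  by (rule iso_cancel_left[of "lunit V \<one>"]) (simp_all add: braid_unit lunit_eq_runit[symmetric])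

text \<open>Sliding a functional \<open>f\<close> off the output of \<open>cap_cup\<close> turns it into a point.\<close>

lemma cmp_cap_cup:
  assumes F: "comm_frobenius_algebra V Q F" and G: "comm_frobenius_algebra V Q G"
    and f: "f \<in> hom V Q \<one>"
  shows "f \<odot> cap_cup V Q F G =
    eps F \<odot> Phi V Q F (runit V Q \<odot> (idm V Q \<otimes> f) \<odot> delta G \<odot> eta G)"
proof -
  interpret F: comm_frobenius_algebra V Q F by fact
  interpret G: comm_frobenius_algebra V Q G by fact
  note [simp] = homD[OF F.mu_hom] homD[OF F.eps_hom] homD[OF G.eta_hom] homD[OF G.delta_hom] homD[OF f]
  define cap where "cap = eps F \<odot> mu F"
  define cup where "cup = delta G \<odot> eta G"
  have cap: "cap \<in> hom V (Q \<boxtimes> Q) \<one>" and cup: "cup \<in> hom V \<one> (Q \<boxtimes> Q)"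
    by (simp_all add: hom_def cap_def cup_def)
  note [simp] = homD[OF cap] homD[OF cup]
  let ?R = "(idm V Q \<otimes> cup) \<odot> inv_arr V (runit V Q)" and ?ai = "inv_arr V (assoc V Q Q Q)"
  have "f \<odot> cap_cup V Q F G = (f \<odot> lunit V Q) \<odot> (cap \<otimes> idm V Q) \<odot> ?ai \<odot> ?R"
    by (simp add: cap_cup_def cup_def[symmetric] cap_def[symmetric])
  also have "\<dots> = lunit V \<one> \<odot> (cap \<otimes> idm V \<one>) \<odot> (idm V (Q \<boxtimes> Q) \<otimes> f) \<odot> ?ai \<odot> ?R"
    by (simp add: lunit_natural[OF f, symmetric] interchange_arr_cmp)
  \<comment> \<open>The cap now slides through the unitor, leaving \<open>f\<close> to be moved
    across the inverse associator by naturality.\<close>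
  also have "\<dots> = cap \<odot> runit V (Q \<boxtimes> Q) \<odot> ((idm V (Q \<boxtimes> Q) \<otimes> f) \<odot> ?ai) \<odot> ?R"
    by (simp add: lunit_eq_runit cmp_reassoc[OF runit_natural[OF cap]])
  also have "(idm V (Q \<boxtimes> Q) \<otimes> f) \<odot> ?ai = inv_arr V (assoc V Q Q \<one>) \<odot> (idm V Q \<otimes> (idm V Q \<otimes> f))"
    by (rule inv_arr_natural[symmetric])
      (use assoc_natural[of "idm V Q" Q Q "idm V Q" Q Q f Q \<one>] f in \<open>simp_all add: hom_def\<close>)
  also have "cap \<odot> runit V (Q \<boxtimes> Q) \<odot> (\<dots>) \<odot> ?R =
      cap \<odot> (runit V (Q \<boxtimes> Q) \<odot> inv_arr V (assoc V Q Q \<one>)) \<odot> (idm V Q \<otimes> (idm V Q \<otimes> f)) \<odot> ?R"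
    by simp
  also have "\<dots> = cap \<odot> (idm V Q \<otimes> (runit V Q \<odot> (idm V Q \<otimes> f) \<odot> cup)) \<odot> inv_arr V (runit V Q)"
    by (simp add: runit_tensor_assoc_inv interchange_arr_cmp)
  finally show ?thesis
    by (simp add: Phi_def cap_def cup_def)
qed

end

section \<open>Multiplication by a point and the Frobenius pairing\<close>

context comm_frobenius_algebra
begin

lemmas structure_homD [simp] =
  homD[OF mu_hom] homD[OF eta_hom] homD[OF delta_hom] homD[OF eps_hom]

lemma Phi_hom:
  assumes "y \<in> hom V \<one> Q"
  shows "Phi V Q F y \<in> hom V Q Q"
  using homD[OF assms] by (simp add: Phi_def hom_def)

text \<open>Multiplication by \<open>y\<close> is recovered from its counit functional: the
  Frobenius law turns comultiplying and then multiplying one leg by \<open>y\<close> into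
  multiplying first and comultiplying afterwards, and the counit removes the extra leg.\<close>

lemma Phi_eq_delta:
  assumes y: "y \<in> hom V \<one> Q"
  shows "runit V Q \<odot> (idm V Q \<otimes> (eps F \<odot> Phi V Q F y)) \<odot> delta F = Phi V Q F y"
proof -
  note [simp] = homD[OF y]
  let ?i = "idm V Q" and ?e = "runit V Q \<odot> (idm V Q \<otimes> eps F)"
  have "runit V Q \<odot> (?i \<otimes> (eps F \<odot> Phi V Q F y)) \<odot> delta F
      = ?e \<odot> (?i \<otimes> mu F) \<odot> (?i \<otimes> (?i \<otimes> y)) \<odot> (?i \<otimes> inv_arr V (runit V Q)) \<odot> delta F"
    by (simp add: Phi_def interchange_arr_cmp)
  \<comment> \<open>Trading the inner unitor for an associator supplies the associator that
    \<open>frobenius_left\<close> requires; naturality then moves \<open>y\<close> and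
    \<open>delta F\<close> to either side of it.\<close>
  also have "\<dots> = ?e \<odot> (?i \<otimes> mu F) \<odot> ((?i \<otimes> (?i \<otimes> y)) \<odot> assoc V Q Q \<one>)
      \<odot> (inv_arr V (runit V (Q \<boxtimes> Q)) \<odot> delta F)"
    by (simp flip: runit_inv_tensor)
  also have "(?i \<otimes> (?i \<otimes> y)) \<odot> assoc V Q Q \<one> = assoc V Q Q Q \<odot> (idm V (Q \<boxtimes> Q) \<otimes> y)"
    using assoc_natural[of ?i Q Q ?i Q Q y \<one> Q] y by (simp add: hom_def)
  also have "inv_arr V (runit V (Q \<boxtimes> Q)) \<odot> delta F = (delta F \<otimes> idm V \<one>) \<odot> inv_arr V (runit V Q)"
    by (rule runit_inv_natural[OF delta_hom])
  also have "?e \<odot> (?i \<otimes> mu F) \<odot> (assoc V Q Q Q \<odot> (idm V (Q \<boxtimes> Q) \<otimes> y))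
        \<odot> ((delta F \<otimes> idm V \<one>) \<odot> inv_arr V (runit V Q))
      = ?e \<odot> ((?i \<otimes> mu F) \<odot> assoc V Q Q Q \<odot> (delta F \<otimes> ?i)) \<odot> (?i \<otimes> y) \<odot> inv_arr V (runit V Q)"
    by (simp add: interchange_arr_cmp)
  also have "\<dots> = (runit V Q \<odot> (?i \<otimes> eps F) \<odot> delta F) \<odot> Phi V Q F y"
    by (simp only: frobenius_left) (simp add: Phi_def)
  also have "\<dots> = Phi V Q F y"
    using homD[OF Phi_hom[OF y]] by (simp only: delta_counit_right) simp
  finally show ?thesis .
qed

lemma Phi_point:
  assumes "x \<in> hom V \<one> Q" "y \<in> hom V \<one> Q"
  shows "Phi V Q F y \<odot> x = mu F \<odot> (x \<otimes> y) \<odot> inv_arr V (lunit V \<one>)"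
  using homD[OF assms(1)] homD[OF assms(2)]
  by (simp add: Phi_def runit_inv_natural[OF assms(1)] interchange_arr_cmp lunit_eq_runit)

lemma Phi_commute:
  assumes "x \<in> hom V \<one> Q" "y \<in> hom V \<one> Q"
  shows "Phi V Q F y \<odot> x = Phi V Q F x \<odot> y"
proof -
  note [simp] = homD[OF assms(1)] homD[OF assms(2)]
  have "Phi V Q F y \<odot> x = (mu F \<odot> braid V Q Q) \<odot> (x \<otimes> y) \<odot> inv_arr V (lunit V \<one>)"
    by (simp only: mu_comm Phi_point[OF assms])
  also have "\<dots> = mu F \<odot> (y \<otimes> x) \<odot> inv_arr V (lunit V \<one>)"
    by (simp add: cmp_reassoc[OF braid_natural[OF assms]] braid_unit_unit)
  finally show ?thesis
    by (simp add: Phi_point[OF assms(2,1)])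
qed

lemma Phi_unit: "Phi V Q F (eta F) = idm V Q"
  by (simp add: Phi_def cmp_reassoc[OF mu_unit_right])

lemma Phi_eta:
  assumes "y \<in> hom V \<one> Q"
  shows "Phi V Q F y \<odot> eta F = y"
  using homD[OF assms] by (simp add: Phi_commute[OF eta_hom assms] Phi_unit)

text \<open>Nondegeneracy of the Frobenius pairing: the functional determines the multiplication map
  by \<open>Phi_eq_delta\<close>, and evaluating that map at the unit returns the point.\<close>

lemma eps_Phi_inject:
  assumes "x \<in> hom V \<one> Q" "y \<in> hom V \<one> Q" "eps F \<odot> Phi V Q F x = eps F \<odot> Phi V Q F y"
  shows "x = y"
  by (metis assms Phi_eq_delta Phi_eta)

text \<open>By \<open>Phi_eq_delta\<close>, \<open>Phi V Q F y\<close> is comultiplication followed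
  by a functional on the second leg. Copying keeps \<open>p\<close> on the first leg and feeds
  \<open>p\<close> to the functional, which yields the eigenvalue.\<close>

lemma Phi_copied_point:
  assumes p: "p \<in> hom V \<one> Q" and copy: "delta F \<odot> p = (p \<otimes> p) \<odot> inv_arr V (lunit V \<one>)"
    and y: "y \<in> hom V \<one> Q"
  shows "Phi V Q F y \<odot> p = p \<odot> eps F \<odot> Phi V Q F y \<odot> p"
proof -
  define l where "l = eps F \<odot> Phi V Q F y"
  have l: "l \<in> hom V Q \<one>"
    unfolding l_def by (rule cmp_hom[OF Phi_hom[OF y] eps_hom])
  note [simp] = homD[OF p] homD[OF l] homD[OF Phi_hom[OF y]]
  have lp: "l \<odot> p \<in> hom V \<one> \<one>"
    by (simp add: hom_def)
  have "Phi V Q F y \<odot> p = (runit V Q \<odot> (idm V Q \<otimes> l) \<odot> delta F) \<odot> p"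
    using Phi_eq_delta[OF y] by (simp only: l_def)
  also have "\<dots> = runit V Q \<odot> (p \<otimes> idm V \<one>) \<odot> (idm V \<one> \<otimes> (l \<odot> p)) \<odot> inv_arr V (lunit V \<one>)"
    by (simp add: copy interchange_arr_cmp)
  also have "\<dots> = p \<odot> lunit V \<one> \<odot> (idm V \<one> \<otimes> (l \<odot> p)) \<odot> inv_arr V (lunit V \<one>)"
    by (simp add: cmp_reassoc[OF runit_natural[OF p]] lunit_eq_runit)
  also have "\<dots> = p \<odot> (l \<odot> p)"
    by (simp only: lunit_conj_scalar(2)[OF lp])
  finally show ?thesis
    by (simp add: l_def)
qed

end

text \<open>A snake identity: pairing \<open>y\<close> by \<open>G\<close> against one leg of the
  cup of \<open>G\<close> gives back \<open>y\<close>, so only the pairing of \<open>F\<close> with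
  \<open>y\<close> remains.\<close>

lemma (in symmetric_monoidal_category) eps_Phi_cap_cup:
  assumes F: "comm_frobenius_algebra V Q F" and G: "comm_frobenius_algebra V Q G"
    and y: "y \<in> hom V \<one> Q"
  shows "(eps G \<odot> Phi V Q G y) \<odot> cap_cup V Q F G = eps F \<odot> Phi V Q F y"
proof -
  interpret G: comm_frobenius_algebra V Q G by fact
  note [simp] = homD[OF G.Phi_hom[OF y]]
  have l: "eps G \<odot> Phi V Q G y \<in> hom V Q \<one>"
    by (simp add: hom_def)
  have "runit V Q \<odot> (idm V Q \<otimes> (eps G \<odot> Phi V Q G y)) \<odot> delta G \<odot> eta G
      = (runit V Q \<odot> (idm V Q \<otimes> (eps G \<odot> Phi V Q G y)) \<odot> delta G) \<odot> eta G"
    by simp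
  also have "\<dots> = y"
    by (simp only: G.Phi_eq_delta[OF y] G.Phi_eta[OF y])
  finally show ?thesis
    by (simp only: cmp_cap_cup[OF F G l])
qed

section \<open>The action of \<tau> on pairings and points\<close>

context GHZ_W_pair
begin

abbreviation "\<tau> \<equiv> tau V Q G W"

lemma tau_hom: "\<tau> \<in> hom V Q Q"
  by (simp add: tau_def cap_cup_def hom_def)

lemmas tau_homD [simp] = GHZ.homD[OF tau_hom]

text \<open>The first equation uses the definition of \<tau>, the second its other form given by
  \<open>alpha\<close>.\<close>

lemma eps_Phi_tau:
  assumes "y \<in> hom V \<one> Q"
  shows "(eps G \<odot> Phi V Q G y) \<odot> \<tau> = eps W \<odot> Phi V Q W y"
    and "(eps W \<odot> Phi V Q W y) \<odot> \<tau> = eps G \<odot> Phi V Q G y"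
  using GHZ.eps_Phi_cap_cup[OF W.comm_frobenius_algebra_axioms GHZ.comm_frobenius_algebra_axioms assms]
    GHZ.eps_Phi_cap_cup[OF GHZ.comm_frobenius_algebra_axioms W.comm_frobenius_algebra_axioms assms]
    alpha by (simp_all only: tau_def)

text \<open>Commutativity makes \<open>eta W\<close> the multiplier; \<tau> converts to the pairing
  of \<open>W\<close>, where multiplication by the unit is the identity.\<close>

lemma eps_Phi_eta:
  assumes y: "y \<in> hom V \<one> Q"
  shows "eps G \<odot> Phi V Q G y \<odot> eta W = eps W \<odot> \<tau> \<odot> y"
proof -
  have "eps G \<odot> Phi V Q G y \<odot> eta W = (eps G \<odot> Phi V Q G (eta W)) \<odot> y"
    using GHZ.homD[OF y] GHZ.homD[OF GHZ.Phi_hom[OF W.eta_hom]]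
    by (simp add: GHZ.Phi_commute[OF W.eta_hom y])
  also have "\<dots> = ((eps W \<odot> Phi V Q W (eta W)) \<odot> \<tau>) \<odot> y"
    by (simp only: eps_Phi_tau(2)[OF W.eta_hom])
  finally show ?thesis
    using GHZ.homD[OF y] by (simp add: W.Phi_unit)
qed

lemma eps_Phi_tau_eta:
  assumes y: "y \<in> hom V \<one> Q"
  shows "eps G \<odot> Phi V Q G y \<odot> \<tau> \<odot> eta W = eps W \<odot> y"
proof -
  note [simp] = GHZ.homD[OF GHZ.Phi_hom[OF y]] GHZ.homD[OF W.Phi_hom[OF y]]
  have "eps G \<odot> Phi V Q G y \<odot> \<tau> \<odot> eta W = ((eps G \<odot> Phi V Q G y) \<odot> \<tau>) \<odot> eta W"
    by simp
  also have "\<dots> = eps W \<odot> Phi V Q W y \<odot> eta W"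
    by (simp only: eps_Phi_tau(1)[OF y]) simp
  finally show ?thesis
    by (simp add: W.Phi_eta[OF y])
qed

text \<open>By \<open>gamma\<close>, \<tau> preserves copying, and \<open>eta W\<close> is copied by
  \<open>beta\<close>.\<close>

lemma delta_tau_eta: "delta G \<odot> \<tau> \<odot> eta W = ((\<tau> \<odot> eta W) \<otimes> (\<tau> \<odot> eta W)) \<odot> inv_arr V (lunit V \<one>)"
proof -
  have "delta G \<odot> \<tau> \<odot> eta W = (delta G \<odot> \<tau>) \<odot> eta W"
    by simp
  also have "\<dots> = (\<tau> \<otimes> \<tau>) \<odot> (delta G \<odot> eta W)"
    by (simp only: gamma) simp
  finally show ?thesis
    by (simp add: beta GHZ.interchange_arr_cmp)
qed

text \<open>Since points separate maps out of \<open>Q\<close>, it suffices to compare \<open>\<epsilon>\<^sub>\<circ> \<mu>\<^sub>\<circ> (\<tau> \<tau> x \<otimes> y)\<close> with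
  \<open>\<epsilon>\<^sub>\<circ> \<mu>\<^sub>\<circ> (x \<otimes> y)\<close>, and \<open>\<tau>\<close> exchanges the two Frobenius pairings.\<close>

lemma tau_tau_point:
  assumes plug: "plugging_set V Q P" and x: "x \<in> hom V \<one> Q"
  shows "\<tau> \<odot> \<tau> \<odot> x = x"
proof (rule GHZ.eps_Phi_inject)
  note [simp] = GHZ.homD[OF x]
  show ttx: "\<tau> \<odot> \<tau> \<odot> x \<in> hom V \<one> Q"
    by (simp add: hom_def)
  note [simp] = GHZ.homD[OF GHZ.Phi_hom[OF x]] GHZ.homD[OF GHZ.Phi_hom[OF ttx]]
  have "(eps G \<odot> Phi V Q G (\<tau> \<odot> \<tau> \<odot> x)) \<odot> y = (eps G \<odot> Phi V Q G x) \<odot> y" if "y \<in> P" for y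
  proof -
    have y: "y \<in> hom V \<one> Q"
      using plug that by (auto simp: plugging_set_def)
    note [simp] = GHZ.homD[OF y] GHZ.homD[OF GHZ.Phi_hom[OF y]] GHZ.homD[OF W.Phi_hom[OF y]]
    \<comment> \<open>Commutativity exchanges the two points, so that both copies of \<tau> can be
      absorbed by the functional of \<open>y\<close>.\<close>
    have "(eps G \<odot> Phi V Q G (\<tau> \<odot> \<tau> \<odot> x)) \<odot> y = (((eps G \<odot> Phi V Q G y) \<odot> \<tau>) \<odot> \<tau>) \<odot> x"
      by (simp add: GHZ.Phi_commute[OF y ttx])
    also have "\<dots> = (eps G \<odot> Phi V Q G y) \<odot> x"
      by (simp only: eps_Phi_tau[OF y])
    finally show ?thesis
      by (simp add: GHZ.Phi_commute[OF y x])
  qed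
  then show "eps G \<odot> Phi V Q G (\<tau> \<odot> \<tau> \<odot> x) = eps G \<odot> Phi V Q G x"
    using plug GHZ.cmp_hom[OF GHZ.Phi_hom[OF x] GHZ.eps_hom]
      GHZ.cmp_hom[OF GHZ.Phi_hom[OF ttx] GHZ.eps_hom] GHZ.unit_obj
    unfolding plugging_set_def by blast
qed (rule x)

end

theorem theorem3p3:
  fixes V :: "('o, 'm, 'b) smc_struct_scheme" (structure)
    and Q :: 'o
    and G W :: "'m frob_struct"
    and \<psi> :: 'm
  assumes "GHZ_W_pair V Q G W"
    and "plugging_set V Q {eta W, tau V Q G W \<odot> eta W}"
    and "\<psi> \<in> hom V \<one> Q"
  shows "Phi_inv V Q G W \<psi> \<odot> Phi V Q G \<psi> =
         (eps W \<odot> \<psi>) \<cdot> (eps W \<odot> tau V Q G W \<odot> \<psi>) \<cdot> idm V Q"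
proof -
  interpret GHZ_W_pair V Q G W by fact
  note plug = assms(2) and y = assms(3)
  define s where "s = eps W \<odot> \<psi>"
  define t where "t = eps W \<odot> \<tau> \<odot> \<psi>"
  define \<Phi> where "\<Phi> = Phi V Q G \<psi>"
  define e where "e = eta W"
  have \<Phi>: "\<Phi> \<in> hom V Q Q" and e: "e \<in> hom V \<one> Q"
    unfolding \<Phi>_def e_def by (rule GHZ.Phi_hom[OF y] W.eta_hom)+
  note [simp] = GHZ.homD[OF y] GHZ.homD[OF \<Phi>] GHZ.homD[OF e]
  have s: "s \<in> hom V \<one> \<one>" and t: "t \<in> hom V \<one> \<one>"
    by (simp_all add: s_def t_def hom_def)
  note [simp] = GHZ.homD[OF s] GHZ.homD[OF t]
  have te: "\<tau> \<odot> e \<in> hom V \<one> Q"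
    by (simp add: hom_def)
  have \<Phi>e: "\<Phi> \<odot> e = e \<odot> t"
    using GHZ.Phi_copied_point[OF W.eta_hom beta y] eps_Phi_eta[OF y]
    by (simp only: \<Phi>_def e_def t_def)
  have \<Phi>te: "\<Phi> \<odot> \<tau> \<odot> e = (\<tau> \<odot> e) \<odot> s"
    using GHZ.Phi_copied_point[OF te[unfolded e_def] delta_tau_eta y] eps_Phi_tau_eta[OF y]
    by (simp only: \<Phi>_def e_def s_def)
  \<comment> \<open>A trailing scalar \<open>k\<close> is carried along because eigenvalues
    accumulate on the right of the point.\<close>
  have \<Phi>e': "\<Phi> \<odot> e \<odot> k = e \<odot> t \<odot> k" and \<Phi>te': "\<Phi> \<odot> \<tau> \<odot> e \<odot> k = \<tau> \<odot> e \<odot> s \<odot> k"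
    if "k \<in> hom V \<one> \<one>" for k
    using GHZ.homD[OF that] GHZ.cmp_reassoc[OF \<Phi>e, of k] GHZ.cmp_reassoc[OF \<Phi>te, of k] by simp_all
  have tte: "\<tau> \<odot> \<tau> \<odot> e \<odot> k = e \<odot> k" if "k \<in> hom V \<one> \<one>" for k
    by (rule tau_tau_point[OF plug GHZ.cmp_hom[OF that e]])
  have st: "s \<odot> t = t \<odot> s" and st_hom: "s \<odot> t \<in> hom V \<one> \<one>" "t \<odot> s \<in> hom V \<one> \<one>"
    using GHZ.scalar_commute[OF s t] by (simp_all add: hom_def)
  define L where "L = Phi_inv V Q G W \<psi> \<odot> Phi V Q G \<psi>"
  define R where "R = s \<cdot> t \<cdot> idm V Q"
  have L: "L \<in> hom V Q Q"
    by (simp add: L_def Phi_inv_def hom_def flip: \<Phi>_def)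
  have tid: "t \<cdot> idm V Q \<in> hom V Q Q"
    by (rule GHZ.scalar_mult_hom[OF t GHZ.idm_hom[OF GHZ.carrier_obj]])
  have R: "R \<in> hom V Q Q"
    unfolding R_def by (rule GHZ.scalar_mult_hom[OF s tid])
  \<comment> \<open>On points, scalar multiplication is precomposition, so nested scalars appear in
    reversed order.\<close>
  have R_point: "R \<odot> p = p \<odot> t \<odot> s" if p: "p \<in> hom V \<one> Q" for p
  proof -
    note [simp] = GHZ.homD[OF p]
    have "R \<odot> p = s \<cdot> t \<cdot> p"
      unfolding R_def
      by (simp add: GHZ.scalar_mult_cmp[OF s tid p]
          GHZ.scalar_mult_cmp[OF t GHZ.idm_hom[OF GHZ.carrier_obj] p])
    also have "\<dots> = s \<cdot> (p \<odot> t)"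
      by (simp only: GHZ.scalar_mult_point[OF t p])
    also have "\<dots> = (p \<odot> t) \<odot> s"
      by (rule GHZ.scalar_mult_point[OF s GHZ.cmp_hom[OF t p]])
    finally show ?thesis
      by simp
  qed
  \<comment> \<open>Here \<Phi> produces \<open>t\<close> at \<open>e\<close> and then
    \<open>s\<close> at \<open>\<tau> \<odot> e\<close>, giving
    \<open>e \<odot> s \<odot> t\<close>; the scalars must be commuted to match \<open>R\<close>. At
    the other point the order already agrees.\<close>
  have "L \<odot> e = R \<odot> e"
    by (simp add: L_def Phi_inv_def R_point[OF e] \<Phi>e \<Phi>te'[OF t] tte[OF st_hom(2)] st flip: \<Phi>_def)
  moreover have "L \<odot> \<tau> \<odot> e = R \<odot> \<tau> \<odot> e"
    by (simp add: L_def Phi_inv_def R_point[OF te] \<Phi>te tte[OF s] \<Phi>e'[OF s] flip: \<Phi>_def)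
  ultimately have "L = R"
    using plug L R GHZ.carrier_obj unfolding plugging_set_def e_def by blast
  then show ?thesis
    by (simp only: L_def R_def s_def t_def)
qed

end
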